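(* Let $k \geq 3$ and let $\mathbb{A} = \{a_1, a_2, \ldots, a_k\}_{\vec r}$ be a sequence of positive integers with $a_1 < a_2 < \cdots < a_k$, $\vec r = (r_1, \ldots, r_k)$, $r_i \geq 1$ for all $i \in [1,k-2]$, $r_{k-1} = 1$ and $r_k \geq 2$. Let $A = \{a_1,\ldots,a_k\}$ with $d(A) = 1$, and let $\alpha < \sum_{i=1}^k r_i - 2$ be a positive integer. Then: (1) If $\alpha < \sum_{i=1}^{k-2} r_i$, then there exists an integer $m \in [1,k-2]$ such that $\sum_{i=1}^{m-1} r_i \leq \alpha < \sum_{i=1}^m r_i$ and \[ |S_\alpha(\mathbb{A})| \geq \begin{cases} a_k + k + \sum_{i=1}^{k-2} i r_i - \sum_{i=1}^m i r_i + m\Big(\sum_{i=1}^m r_i - \alpha\Big) + (k-m+1)(r_k - 1) & \text{if } a_k \leq 2k-3,\\ \theta(k+1) + k - 4 + \sum_{i=1}^{k-2} i r_i - \sum_{i=1}^m i r_i + m\Big(\sum_{i=1}^m r_i - \alpha\Big) + (k-m+1)(r_k - 1) & \text{if } a_k \geq 2k-2. \end{cases} \] (2) If $\sum_{i=1}^{k-2} r_i \leq \alpha < \sum_{i=1}^k r_i - 2$, then \[ |S_\alpha(\mathbb{A})| \geq \begin{cases} a_k - k + 2 + (k-1)\Big(\sum_{i=1}^k r_i - \alpha\Big) & \text{if } a_k \leq 2k-3,\\ \theta(k+1) - k - 2 + (k-1)\Big(\sum_{i=1}^k r_i - \alpha\Big) & \text{if } a_k \geq 2k-2. \end{cases} 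\]
   Context: The notation $\mathbb{A} = \{a_1, \ldots, a_k\}_{\vec r}$ with $\vec r = (r_1,\ldots,r_k)$ means $\mathbb{A}$ is a finite sequence consisting of the $k$ distinct integers $a_1,\ldots,a_k$, where $a_i$ appears exactly $r_i$ times. For a positive integer $\alpha$, $S_\alpha(\mathbb{A}) = \{\sum_{b\in\mathbb{B}} b : \mathbb{B} \text{ a subsequence of } \mathbb{A},\ |\mathbb{B}| \geq \alpha\}$, where $|\mathbb{B}|$ counts terms with multiplicity. $d(A)$ is the gcd of the elements of $A$. $\theta = \frac{1+\sqrt5}{2}$. Empty sums are $0$. *)

theory Defs
  imports Complex_Main "HOL-Library.Multiset"
begin

text \<open>
  Subsequence sums do not depend on the order of the terms, so finite sequences of integers are
  represented as multisets and subsequences as sub-multisets.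
\<close>

definition seq_of :: "nat \<Rightarrow> (nat \<Rightarrow> int) \<Rightarrow> (nat \<Rightarrow> nat) \<Rightarrow> int multiset" where
  "seq_of k a r = (\<Sum>i=1..k. replicate_mset (r i) (a i))"

definition subseq_sums :: "nat \<Rightarrow> int multiset \<Rightarrow> int set" where
  "subseq_sums \<alpha> \<A> = {\<Sum>\<^sub># \<B> | \<B>. \<B> \<subseteq># \<A> \<and> size \<B> \<ge> \<alpha>}"

definition golden_ratio :: real where
  "golden_ratio = (1 + sqrt 5) / 2"

end

theory Submission
  imports Defs
begin

text \<open>
  Let \<open>l = a k\<close>, let \<open>A = {0, a 1, \<dots>, a (k-1)}\<close> and let \<open>T\<close> consist of 0 and the sums of two
  distinct elements of \<open>A\<close> modulo \<open>l\<close>.  Passing to complements, \<open>S\<^sub>\<alpha>\<close> becomes the set of sums of at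
  most \<open>\<beta>\<close> terms.  For \<open>3 \<le> \<beta> \<le> r k + 1\<close> the copies of \<open>a k\<close> give at least \<open>\<beta> - 1\<close> such sums in
  every class of \<open>T\<close>, and one more in every class of \<open>A\<close>.  If \<open>l \<le> 2k - 3\<close>, the pigeonhole principle
  makes \<open>T\<close> the whole of \<open>\<int>/l\<int>\<close>.  If \<open>l \<ge> 2k - 2\<close>, an analogue for restricted sums of the theorem
  that \<open>|A + A| < 3|A|/2\<close> forces \<open>A - A\<close> to be a subgroup gives \<open>2|T| \<ge> 3k - 3\<close>; as every \<open>\<beta>\<close> that
  occurs is at least 3, this already beats the golden ratio bound.  Larger \<open>\<beta>\<close> are reached by lowering
  \<open>\<alpha>\<close> one at a time, each step creating new sums below all previous ones.
\<close>

section \<open>Sums of two distinct residues modulo \<open>l\<close>\<close>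

text \<open>Induction on \<open>F\<close> with Bezout's identity. It serves to put 1 into the
  stabiliser of a difference set.\<close>

lemma Gcd_mem_additive_subgroup:
  fixes H :: "int set"
  assumes "finite F" "F \<subseteq> H" "0 \<in> H"
    and add: "\<And>x y. x \<in> H \<Longrightarrow> y \<in> H \<Longrightarrow> x + y \<in> H"
    and scale: "\<And>c x. x \<in> H \<Longrightarrow> c * x \<in> H"
  shows "Gcd F \<in> H"
  using assms(1,2)
proof (induction F)
  case empty
  then show ?case using \<open>0 \<in> H\<close> by simp
next
  case (insert x F)
  obtain u v where "u * x + v * Gcd F = gcd x (Gcd F)"
    using bezout_int by blast
  then have "gcd x (Gcd F) \<in> H"
    using add scale insert by (metis insert_subset)
  then show ?case by simp
qed

text \<open>Summands are distinct because a term may occur only once. The inserted 0 is the empty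
  sum, which need not be a sum of two distinct elements.\<close>

definition mod_pair_sums :: "int \<Rightarrow> int set \<Rightarrow> int set" where
  "mod_pair_sums l A = insert 0 {(x + y) mod l | x y. x \<in> A \<and> y \<in> A \<and> x \<noteq> y}"

lemma mod_pair_sums_subset:
  assumes "l > 0"
  shows "mod_pair_sums l A \<subseteq> {0..<l}"
  using assms by (auto simp: mod_pair_sums_def)

lemma subset_mod_pair_sums:
  assumes "A \<subseteq> {0..<l}" "0 \<in> A"
  shows "A \<subseteq> mod_pair_sums l A"
proof
  fix x assume x: "x \<in> A"
  show "x \<in> mod_pair_sums l A"
  proof (cases "x = 0")
    case False
    have "x = (x + 0) mod l" using x assms by auto
    then show ?thesis using x False assms unfolding mod_pair_sums_def by blast
  qed (simp add: mod_pair_sums_def)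
qed

lemma inj_on_add_mod:
  fixes l :: int
  assumes "A \<subseteq> {0..<l}"
  shows "inj_on (\<lambda>y. (c + y) mod l) A"
proof (rule inj_onI)
  fix x y assume xy: "x \<in> A" "y \<in> A" and "(c + x) mod l = (c + y) mod l"
  then have "x mod l = y mod l"
    by (metis add_diff_cancel_left' mod_diff_left_eq)
  moreover have "x mod l = x" "y mod l = y" using xy assms by auto
  ultimately show "x = y" by simp
qed

lemma inj_on_diff_mod:
  fixes l :: int
  assumes "A \<subseteq> {0..<l}"
  shows "inj_on (\<lambda>y. (c - y) mod l) A"
proof (rule inj_onI)
  fix x y assume xy: "x \<in> A" "y \<in> A" and "(c - x) mod l = (c - y) mod l"
  then have "(c - (c - x)) mod l = (c - (c - y)) mod l"
    by (metis mod_diff_right_eq)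
  then have "x mod l = y mod l" by simp
  moreover have "x mod l = x" "y mod l = y" using xy assms by auto
  ultimately show "x = y" by simp
qed

text \<open>Source of the lower bounds on numbers of representations below: two large subsets of a
  small set overlap.\<close>

lemma card_Int_ge:
  assumes "finite T" "X \<subseteq> T" "Y \<subseteq> T"
  shows "card X + card Y \<le> card T + card (X \<inter> Y)"
proof -
  have "card X + card Y = card (X \<union> Y) + card (X \<inter> Y)"
    using assms by (intro card_Un_Int) (auto intro: finite_subset)
  also have "card (X \<union> Y) \<le> card T" using assms by (intro card_mono) auto
  finally show ?thesis by simp
qed

text \<open>Every residue has at least three representations as an ordered sum of two elements of
  \<open>A\<close>, while \<open>2y = c\<close> has at most two solutions modulo \<open>l\<close>.\<close>

lemma mod_pair_sums_eq_all_residues: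
  fixes l :: int
  assumes l0: "l > 0" and A: "A \<subseteq> {0..<l}" and l: "l \<le> 2 * int (card A) - 3"
  shows "mod_pair_sums l A = {0..<l}"
proof -
  have "c \<in> mod_pair_sums l A" if c: "c \<in> {0..<l}" for c
  proof -
    let ?f = "\<lambda>y. (c - y) mod l"
    let ?W = "{y\<in>A. ?f y \<in> A}"
    have finA: "finite A" using A finite_subset by blast
    have "card A + card (?f ` A) \<le> card {0..<l} + card (A \<inter> ?f ` A)"
      using A l0 by (intro card_Int_ge) auto
    moreover have "card (?f ` A) = card A"
      by (intro card_image inj_on_diff_mod A)
    moreover have "card (A \<inter> ?f ` A) \<le> card (?f ` ?W)"
      using finA by (intro card_mono) auto
    moreover have "card (?f ` ?W) \<le> card ?W"
      using finA by (intro card_image_le) auto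
    moreover have "int (card {0..<l}) = l" using l0 by simp
    ultimately have W: "card ?W \<ge> 3" using l by linarith
    \<comment> \<open>A solution of \<open>2y = c\<close> modulo \<open>l\<close> in the range
      satisfies \<open>2y = c\<close> or \<open>2y = c + l\<close>. For the wrong parity the rounded
      quotient merely excludes a harmless extra value.\<close>
    have "card {c div 2, (c + l) div 2} \<le> 2" by (simp add: card_insert_if)
    then have "\<not> ?W \<subseteq> {c div 2, (c + l) div 2}"
      using W card_mono[of "{c div 2, (c + l) div 2}" ?W] by fastforce
    then obtain y where y: "y \<in> A" "?f y \<in> A" "y \<noteq> c div 2" "y \<noteq> (c + l) div 2" by auto
    have "?f y \<noteq> y"
    proof
      assume e: "?f y = y"
      have yl: "0 \<le> y" "y < l" using y(1) A by auto
      have "c - y = l * ((c - y) div l) + y" using e mult_div_mod_eq[of l "c - y"] by simp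
      then have eq: "c = l * ((c - y) div l) + 2 * y" by simp
      have "0 \<le> c" "c < l" using c by auto
      have "(c - y) div l = 0 \<or> (c - y) div l = -1"
      proof -
        consider "c - y \<ge> 0" | "c - y < 0" by linarith
        then show ?thesis
        proof cases
          case 1
          then have "(c - y) div l = 0" using \<open>c < l\<close> yl by (intro div_pos_pos_trivial) auto
          then show ?thesis ..
        next
          case 2
          then have "(c - y) div l = -1"
            using \<open>0 \<le> c\<close> yl by (intro int_div_pos_eq[where r = "c - y + l"]) auto
          then show ?thesis ..
        qed
      qed
      then show False using eq y(3,4) by auto
    qed
    moreover have "(y + ?f y) mod l = c"
      using c by (simp add: mod_add_right_eq)
    ultimately show ?thesis
      using y unfolding mod_pair_sums_def by (metis (mono_tags, lifting) insertI2 mem_Collect_eq)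
  qed
  then show ?thesis using mod_pair_sums_subset[OF l0] by blast
qed

text \<open>If there are few pair sums, every difference of elements of \<open>A\<close> has many representations.
  Hence two such representations can be chosen with a common element, so the differences form a
  subgroup, which is everything; but then there are more than \<open>(card A)\<^sup>2\<close> representations.\<close>

lemma card_mod_pair_sums_ge:
  fixes l :: int
  assumes A: "A \<subseteq> {0..<l}" and A0: "0 \<in> A" and k3: "card A \<ge> 3"
    and gcd: "Gcd (insert l A) = 1" and l: "l \<ge> 2 * int (card A) - 2"
  shows "2 * int (card (mod_pair_sums l A)) \<ge> 3 * int (card A) - 3"
proof (rule ccontr)
  assume few: "\<not> ?thesis"
  define T where "T = mod_pair_sums l A"
  define k where "k = int (card A)"
  define t where "t = int (card T)"
  \<comment> \<open>\<open>P d\<close> lists the representations of \<open>d\<close> as a difference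
    of elements of \<open>A\<close> modulo \<open>l\<close>, by the subtracted element;
    \<open>D\<close> is the set of differences.\<close>
  define P where "P d = {x\<in>A. (x + d) mod l \<in> A}" for d
  define D where "D = {d\<in>{0..<l}. P d \<noteq> {}}"
  have l0: "l > 0" using A A0 by auto
  have t: "2 * t \<le> 3 * k - 4" using few by (simp add: t_def k_def T_def)
  have finA: "finite A" using A finite_subset by blast
  have finP: "finite (P d)" for d using finA by (simp add: P_def)
  have finT: "finite T" using mod_pair_sums_subset[OF l0] finite_subset unfolding T_def by blast
  have Amod: "x mod l = x" if "x \<in> A" for x using that A by auto
  define X where "X x = (\<lambda>y. (x + y) mod l) ` (A - {x})" for x
  have XT: "X x \<subseteq> T" if "x \<in> A" for x
    using that by (auto simp: X_def T_def mod_pair_sums_def)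
  have cX: "int (card (X x)) = k - 1" if "x \<in> A" for x
  proof -
    have "card (X x) = card (A - {x})"
      unfolding X_def by (intro card_image inj_on_add_mod) (use A in auto)
    then show ?thesis using that finA k3 by (simp add: k_def)
  qed
  \<comment> \<open>Comparing \<open>X x\<close> with \<open>A\<close> itself, which has one element
    more than a translate \<open>X y\<close>, gains 1 over the bound \<open>PD\<close>. This 1 is
    decisive in \<open>closed\<close>.\<close>
  have PA: "int (card (P x)) \<ge> 2 * k - 1 - t" if x: "x \<in> A" for x
  proof -
    have "A \<subseteq> T" using subset_mod_pair_sums[OF A A0] by (simp add: T_def)
    then have "card (X x) + card A \<le> card T + card (X x \<inter> A)"
      using XT[OF x] finT by (intro card_Int_ge) auto
    moreover have "X x \<inter> A \<subseteq> (\<lambda>y. (x + y) mod l) ` P x"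
      by (auto simp: X_def P_def add.commute)
    then have "card (X x \<inter> A) \<le> card ((\<lambda>y. (x + y) mod l) ` P x)"
      using finP by (intro card_mono) auto
    moreover have "card ((\<lambda>y. (x + y) mod l) ` P x) \<le> card (P x)"
      using finP by (intro card_image_le)
    ultimately show ?thesis using cX[OF x] by (simp add: k_def t_def)
  qed
  \<comment> \<open>For \<open>y = x + d\<close>, a coincidence \<open>x + u = y + b\<close> forces
    \<open>u = b + d\<close>, so it yields a representation of \<open>d\<close>.\<close>
  have PD: "int (card (P d)) \<ge> 2 * k - 2 - t" if d: "d \<in> D" for d
  proof -
    obtain x where x: "x \<in> A" "(x + d) mod l \<in> A" using d by (auto simp: D_def P_def)
    define y where "y = (x + d) mod l"
    have y: "y \<in> A" using x y_def by simp
    have "card (X x) + card (X y) \<le> card T + card (X x \<inter> X y)"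
      using XT[OF x(1)] XT[OF y] finT by (intro card_Int_ge) auto
    moreover have "X x \<inter> X y \<subseteq> (\<lambda>b. (y + b) mod l) ` P d"
    proof
      fix z assume "z \<in> X x \<inter> X y"
      then obtain u b where ub: "u \<in> A" "b \<in> A" "z = (x + u) mod l" "z = (y + b) mod l"
        unfolding X_def by blast
      have "(x + u) mod l = (x + (b + d)) mod l"
        using ub unfolding y_def by (simp add: mod_simps add_ac)
      then have "u mod l = (b + d) mod l"
        by (metis add_diff_cancel_left' mod_diff_left_eq)
      then have "b \<in> P d" using ub Amod by (simp add: P_def)
      then show "z \<in> (\<lambda>b. (y + b) mod l) ` P d" using ub by blast
    qed
    then have "card (X x \<inter> X y) \<le> card ((\<lambda>b. (y + b) mod l) ` P d)"
      using finP by (intro card_mono) auto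
    moreover have "card ((\<lambda>b. (y + b) mod l) ` P d) \<le> card (P d)"
      using finP by (intro card_image_le)
    ultimately show ?thesis using cX[OF x(1)] cX[OF y] by (simp add: k_def t_def)
  qed
  \<comment> \<open>The two bounds add up to at least \<open>k + 1\<close>, so some \<open>b\<close>
    lies in both sets; then \<open>b + d\<close> and \<open>b + x\<close> are elements of
    \<open>A\<close> with difference \<open>d - x\<close>.\<close>
  have closed: "(d - x) mod l \<in> D" if d: "d \<in> D" and x: "x \<in> A" for d x
  proof -
    have "card (P d) + card (P x) \<le> card A + card (P d \<inter> P x)"
      using finA by (intro card_Int_ge) (auto simp: P_def)
    then have "card (P d \<inter> P x) > 0" using PD[OF d] PA[OF x] t by (simp add: k_def)
    then obtain b where b: "b \<in> P d" "b \<in> P x" by (metis Int_iff card_gt_0_iff ex_in_conv)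
    have "((b + x) mod l + (d - x) mod l) mod l = (b + d) mod l"
      by (simp add: mod_add_eq)
    then have "(b + x) mod l \<in> P ((d - x) mod l)" using b by (simp add: P_def)
    then show ?thesis using l0 by (auto simp: D_def)
  qed
  \<comment> \<open>The translations preserving \<open>D\<close>. By \<open>closed\<close> they
    include \<open>- x\<close> for all \<open>x\<close> in \<open>A\<close>, and also
    \<open>l\<close>, so the gcd condition yields 1 and \<open>D\<close> contains every
    residue.\<close>
  define H where "H = {h. \<forall>d\<in>D. (d + h) mod l \<in> D}"
  have D_mod: "d mod l = d" if "d \<in> D" for d using that by (auto simp: D_def)
  have H0: "0 \<in> H" using D_mod by (auto simp: H_def)
  have Hadd: "x + y \<in> H" if "x \<in> H" "y \<in> H" for x y
  proof -
    have "(d + (x + y)) mod l \<in> D" if "d \<in> D" for d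
    proof -
      have "((d + x) mod l + y) mod l \<in> D"
        using \<open>d \<in> D\<close> \<open>x \<in> H\<close> \<open>y \<in> H\<close> unfolding H_def by blast
      then show ?thesis by (simp add: mod_simps add_ac)
    qed
    then show ?thesis by (simp add: H_def)
  qed
  have Hnat: "int n * x \<in> H" if "x \<in> H" for n x
    by (induction n) (use H0 Hadd that in \<open>auto simp: algebra_simps\<close>)
  have Hcong: "x \<in> H \<longleftrightarrow> y \<in> H" if "x mod l = y mod l" for x y
  proof -
    have "(d + x) mod l = (d + y) mod l" for d
      using that by (intro mod_add_cong) auto
    then show ?thesis by (simp add: H_def)
  qed
  have Hscale: "c * x \<in> H" if "x \<in> H" for c x
  proof -
    \<comment> \<open>Only \<open>c mod l\<close> matters, which turns negative multiples into
      nonnegative ones.\<close>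
    have "int (nat (c mod l)) * x \<in> H" using Hnat that by blast
    then have "(c mod l) * x \<in> H" using l0 by simp
    then show ?thesis using Hcong[of "(c mod l) * x" "c * x"] by (simp add: mod_mult_left_eq)
  qed
  have "x \<in> H" if "x \<in> A" for x
  proof -
    have "- x \<in> H" using closed that by (simp add: H_def)
    then have "(- 1) * (- x) \<in> H" by (rule Hscale)
    then show ?thesis by simp
  qed
  moreover have "l \<in> H" using Hcong[of l 0] H0 by simp
  ultimately have "Gcd (insert l A) \<in> H"
    using finA H0 Hadd Hscale by (intro Gcd_mem_additive_subgroup) auto
  then have "1 \<in> H" unfolding gcd .
  have "0 \<in> D" using A0 l0 by (auto simp: D_def P_def)
  have D: "d \<in> D" if "d \<in> {0..<l}" for d
  proof -
    have "d * 1 \<in> H" using \<open>1 \<in> H\<close> by (rule Hscale)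
    then have "(0 + d) mod l \<in> D"
      using \<open>0 \<in> D\<close> unfolding H_def by (metis (lifting) mem_Collect_eq mult.right_neutral)
    then show ?thesis using that by auto
  qed
  \<comment> \<open>Double counting: an ordered pair from \<open>A\<close> represents exactly one
    difference.\<close>
  have "(\<Sum>d\<in>{0..<l}. card (P d)) = card (SIGMA d:{0..<l}. P d)"
    using finP by simp
  also have "\<dots> \<le> card (A \<times> A)"
  proof (rule card_inj_on_le[where f = "\<lambda>(d, x). (x, (x + d) mod l)"])
    show "inj_on (\<lambda>(d, x). (x, (x + d) mod l)) (SIGMA d:{0..<l}. P d)"
    proof (rule inj_onI)
      fix p q assume pq: "p \<in> (SIGMA d:{0..<l}. P d)" "q \<in> (SIGMA d:{0..<l}. P d)"
        "(\<lambda>(d, x). (x, (x + d) mod l)) p = (\<lambda>(d, x). (x, (x + d) mod l)) q"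
      have "fst p = fst q"
        by (rule inj_onD[OF inj_on_add_mod[of "{0..<l}" l "snd p"]]) (use pq in auto)
      then show "p = q" using pq(3) by (auto simp: case_prod_unfold prod_eq_iff)
    qed
  qed (use finA in \<open>auto simp: P_def\<close>)
  finally have upper: "(\<Sum>d\<in>{0..<l}. int (card (P d))) \<le> k * k"
    unfolding k_def by (simp flip: of_nat_sum of_nat_mult add: card_cartesian_product)
  \<comment> \<open>The bound \<open>PD\<close>, improved by 1 through \<open>PA\<close> on nonzero
    elements of \<open>A\<close>, and replaced by the exact value \<open>k\<close> at
    \<open>d = 0\<close>.\<close>
  define w where "w d = (2 * k - 2 - t) + (if d \<in> A - {0} then 1 else 0)
    + (if d = 0 then k - (2 * k - 2 - t) else 0)" for d
  have "w d \<le> int (card (P d))" if "d \<in> {0..<l}" for d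
  proof (cases "d = 0")
    case True
    have "P 0 = A" using Amod by (auto simp: P_def)
    then show ?thesis using True by (simp add: w_def k_def)
  next
    case False
    then show ?thesis using PA[of d] PD[OF D[OF that]] by (auto simp: w_def)
  qed
  then have "(\<Sum>d\<in>{0..<l}. w d) \<le> k * k"
    by (intro order_trans[OF sum_mono upper])
  moreover have "(\<Sum>d\<in>{0..<l}. w d) = l * (2 * k - 2 - t) + (k - 1) + (k - (2 * k - 2 - t))"
  proof -
    have "{0..<l} \<inter> {d. d \<in> A - {0}} = A - {0}" using A by auto
    then have "(\<Sum>d\<in>{0..<l}. if d \<in> A - {0} then 1 else 0) = int (card (A - {0}))"
      by (simp flip: sum.inter_restrict add: sum.If_cases)
    also have "\<dots> = k - 1" using A0 finA k3 by (simp add: k_def)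
    finally have "(\<Sum>d\<in>{0..<l}. if d \<in> A - {0} then 1 else 0) = k - 1" .
    moreover have "(\<Sum>d\<in>{0..<l}. if d = 0 then k - (2 * k - 2 - t) else 0) = k - (2 * k - 2 - t)"
      using l0 by simp
    ultimately show ?thesis
      using l0 unfolding w_def sum.distrib by simp
  qed
  ultimately have 1: "(l - 1) * (2 * k - 2 - t) + 2 * k - 1 \<le> k * k" by (simp add: algebra_simps)
  have k: "k \<ge> 3" "l - 1 \<ge> 2 * k - 3" using k3 l by (simp_all add: k_def)
  \<comment> \<open>Here \<open>2 * (2 * k - 2 - t)\<close> is at least \<open>k\<close>; the count
    then collapses to \<open>k \<le> 2\<close>.\<close>
  have "(2 * k - 3) * k \<le> (l - 1) * (2 * (2 * k - 2 - t))"
    using k t by (intro mult_mono) auto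
  then have "(2 * k - 3) * k + 4 * k - 2 \<le> 2 * (k * k)" using 1 by (simp add: algebra_simps)
  then show False using k by (simp add: algebra_simps)
qed

section \<open>Subsequences as vectors of multiplicities\<close>

lemma count_seq_of:
  assumes "inj_on a {1..k}" "j \<in> {1..k}"
  shows "count (seq_of k a r) (a j) = r j"
proof -
  have "count (seq_of k a r) (a j) = (\<Sum>i=1..k. if a j = a i then r i else 0)"
    by (simp add: seq_of_def count_sum)
  also have "\<dots> = (\<Sum>i=1..k. if i = j then r i else 0)"
    using assms by (intro sum.cong) (auto simp: inj_on_eq_iff[OF assms(1)])
  also have "\<dots> = r j" using assms by simp
  finally show ?thesis .
qed

lemma set_mset_seq_of: "set_mset (seq_of k a r) \<subseteq> a ` {1..k}"
  by (auto simp: seq_of_def set_mset_sum split: if_splits)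

lemma size_seq_of: "size (seq_of k a x) = (\<Sum>i=1..k. x i)"
  by (simp add: seq_of_def)

lemma sum_mset_seq_of: "\<Sum>\<^sub># (seq_of k a x) = (\<Sum>i=1..k. int (x i) * a i)"
proof -
  have "\<Sum>\<^sub># (\<Sum>i\<in>I. replicate_mset (x i) (a i)) = (\<Sum>i\<in>I. int (x i) * a i)" if "finite I" for I
    using that by (induction I) auto
  then show ?thesis by (simp add: seq_of_def)
qed

lemma subseq_sums_seq_of:
  assumes inj: "inj_on a {1..k}"
  shows "subseq_sums \<alpha> (seq_of k a r) =
    {\<Sum>i=1..k. int (x i) * a i | x. (\<forall>i\<in>{1..k}. x i \<le> r i) \<and> \<alpha> \<le> (\<Sum>i=1..k. x i)}"
    (is "?L = ?R")
proof (intro equalityI subsetI)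
  fix s assume "s \<in> ?L"
  then obtain B where B: "B \<subseteq># seq_of k a r" "size B \<ge> \<alpha>" "s = \<Sum>\<^sub># B"
    by (auto simp: subseq_sums_def)
  define x where "x i = count B (a i)" for i
  have "B = seq_of k a x"
  proof (rule multiset_eqI)
    fix b
    show "count B b = count (seq_of k a x) b"
    proof (cases "b \<in> a ` {1..k}")
      case True
      then show ?thesis using count_seq_of[OF inj] by (auto simp: x_def)
    next
      case False
      then have "b \<notin># B" "b \<notin># seq_of k a x"
        using set_mset_seq_of B(1) by (meson mset_subset_eqD subset_iff)+
      then show ?thesis by (metis not_in_iff)
    qed
  qed
  moreover have "x i \<le> r i" if "i \<in> {1..k}" for i
    using count_seq_of[OF inj that, of r] mset_subset_eq_count[OF B(1), of "a i"] by (simp add: x_def)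
  ultimately show "s \<in> ?R"
    using B by (auto simp: size_seq_of sum_mset_seq_of)
next
  fix s assume "s \<in> ?R"
  then obtain x where x: "\<forall>i\<in>{1..k}. x i \<le> r i" "\<alpha> \<le> (\<Sum>i=1..k. x i)"
    "s = (\<Sum>i=1..k. int (x i) * a i)" by auto
  have "seq_of k a x \<subseteq># seq_of k a r"
  proof (rule mset_subset_eqI)
    fix b
    show "count (seq_of k a x) b \<le> count (seq_of k a r) b"
      unfolding seq_of_def count_sum using x(1) by (intro sum_mono) auto
  qed
  then show "s \<in> ?L"
    using x unfolding subseq_sums_def
    by (auto intro!: exI[of _ "seq_of k a x"] simp: size_seq_of sum_mset_seq_of)
qed

lemma finite_submultisets: "finite {B. B \<subseteq># M}"
proof (induction M)
  case (add b M)
  have "B \<in> {B. B \<subseteq># M} \<union> add_mset b ` {B. B \<subseteq># M}" if "B \<subseteq># add_mset b M" for B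
  proof (cases "b \<in># B")
    case True
    then have "B = add_mset b (B - {#b#})" by simp
    moreover have "B - {#b#} \<subseteq># M" using that by (simp add: subset_eq_diff_conv)
    ultimately show ?thesis by blast
  next
    case False
    have "count B c \<le> count M c" for c
      using mset_subset_eq_count[OF that, of c] False[unfolded not_in_iff] by (cases "c = b") auto
    then show ?thesis by (simp add: mset_subset_eqI)
  qed
  then have "{B. B \<subseteq># add_mset b M} \<subseteq> {B. B \<subseteq># M} \<union> add_mset b ` {B. B \<subseteq># M}"
    by (intro subsetI) simp
  then show ?case by (rule finite_subset) (simp add: add)
qed simp

lemma finite_subseq_sums: "finite (subseq_sums \<alpha> M)"
proof -
  have "subseq_sums \<alpha> M \<subseteq> sum_mset ` {B. B \<subseteq># M}" by (auto simp: subseq_sums_def)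
  then show ?thesis using finite_submultisets finite_subset by blast
qed

text \<open>Complementation: the multiplicities \<open>r i - x i\<close> of the remaining terms
  still add up to at least \<alpha>.\<close>

lemma total_minus_mem_subseq_sums:
  assumes inj: "inj_on a {1..k}" and x: "\<forall>i\<in>{1..k}. x i \<le> r i"
    and size: "(\<Sum>i=1..k. x i) + \<alpha> \<le> (\<Sum>i=1..k. r i)"
  shows "(\<Sum>i=1..k. int (r i) * a i) - (\<Sum>i=1..k. int (x i) * a i)
    \<in> subseq_sums \<alpha> (seq_of k a r)"
proof -
  have "(\<Sum>i=1..k. int (r i) * a i) - (\<Sum>i=1..k. int (x i) * a i)
    = (\<Sum>i=1..k. int (r i - x i) * a i)"
    unfolding sum_subtractf[symmetric] using x
    by (intro sum.cong) (auto simp: algebra_simps)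
  moreover have "(\<Sum>i=1..k. r i - x i) + (\<Sum>i=1..k. x i) = (\<Sum>i=1..k. r i)"
    unfolding sum.distrib[symmetric] using x by (intro sum.cong) auto
  ultimately show ?thesis
    using size unfolding subseq_sums_seq_of[OF inj]
    by (auto intro!: exI[of _ "\<lambda>i. r i - x i"])
qed

section \<open>Lowering the threshold, and counting by residues modulo \<open>a k\<close>\<close>

locale repeated_terms =
  fixes k :: nat and a :: "nat \<Rightarrow> int" and r :: "nat \<Rightarrow> nat"
  assumes a_pos: "\<And>i. i \<in> {1..k} \<Longrightarrow> a i > 0"
    and a_mono: "strict_mono_on {1..k} a"
    and r_pos: "\<And>i. i \<in> {1..k} \<Longrightarrow> r i \<ge> 1"
begin

abbreviation S :: "nat \<Rightarrow> int set" where "S \<alpha> \<equiv> subseq_sums \<alpha> (seq_of k a r)"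

abbreviation R :: "nat \<Rightarrow> nat" where "R j \<equiv> \<Sum>i=1..j. r i"

lemma a_less_iff: "i \<in> {1..k} \<Longrightarrow> j \<in> {1..k} \<Longrightarrow> a i < a j \<longleftrightarrow> i < j"
  using a_mono by (auto simp: strict_mono_on_less)

lemma inj_a: "inj_on a {1..k}"
  using a_mono strict_mono_on_imp_inj_on by blast

text \<open>If \<open>\<sigma>\<close> is the sum of the \<open>\<alpha> + 1\<close> smallest terms, then the numbers \<open>\<sigma> - a i\<close> with
  \<open>i \<le> j\<close> lie in \<open>S \<alpha>\<close> but below all of \<open>S (\<alpha> + 1)\<close>.\<close>

lemma card_S_Suc:
  assumes j: "j \<in> {1..k}" and lower: "R (j - 1) \<le> \<alpha>" and upper: "\<alpha> < R j"
  shows "card (S (Suc \<alpha>)) + j \<le> card (S \<alpha>)"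
proof -
  have Rj: "R j = R (j - 1) + r j" using j by (cases j) auto
  \<comment> \<open>Multiplicities of the \<open>\<alpha> + 1\<close> smallest terms: full blocks
    before \<open>j\<close>, and between 1 and \<open>r j\<close> copies of
    \<open>a j\<close>.\<close>
  define p where "p i = (if i < j then r i else if i = j then Suc \<alpha> - R (j - 1) else 0)" for i
  define \<sigma> where "\<sigma> = (\<Sum>i=1..k. int (p i) * a i)"
  have p_le: "p i \<le> r i" for i using upper Rj by (auto simp: p_def)
  have p_pos: "p i \<ge> 1" if "i \<in> {1..j}" for i
    using that j lower r_pos[of i] by (auto simp: p_def)
  have size_p: "(\<Sum>i=1..k. p i) = Suc \<alpha>"
  proof -
    have "(\<Sum>i=1..k. p i) = (\<Sum>i=1..j. p i)"
      using j by (intro sum.mono_neutral_right) (auto simp: p_def)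
    also have "\<dots> = (\<Sum>i=1..j-1. p i) + p j" using j by (cases j) auto
    also have "(\<Sum>i=1..j-1. p i) = R (j - 1)"
      using j by (intro sum.cong) (auto simp: p_def)
    finally show ?thesis using lower by (simp add: p_def)
  qed
  have minimal: "\<sigma> \<le> s" if "s \<in> S (Suc \<alpha>)" for s
  proof -
    from that obtain x where x: "\<forall>i\<in>{1..k}. x i \<le> r i" "Suc \<alpha> \<le> (\<Sum>i=1..k. x i)"
      "s = (\<Sum>i=1..k. int (x i) * a i)"
      unfolding subseq_sums_seq_of[OF inj_a] by auto
    \<comment> \<open>With weights centred at \<open>a j\<close>, \<open>p\<close> is maximal where
      they are negative and zero where they are positive. Surplus terms cannot help, as
      \<open>a j > 0\<close>.\<close>
    have "(\<Sum>i=1..k. int (p i) * (a i - a j)) \<le> (\<Sum>i=1..k. int (x i) * (a i - a j))"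
    proof (rule sum_mono)
      fix i assume i: "i \<in> {1..k}"
      consider "i < j" | "i = j" | "i > j" by linarith
      then show "int (p i) * (a i - a j) \<le> int (x i) * (a i - a j)"
      proof cases
        case 1
        then have "a i < a j" using a_less_iff i j by simp
        moreover have "int (x i) \<le> int (p i)" using 1 x(1) i by (simp add: p_def)
        ultimately show ?thesis by (intro mult_right_mono_neg) auto
      next
        case 3
        then have "a j < a i" using a_less_iff i j by simp
        then show ?thesis using 3 by (simp add: p_def)
      qed simp
    qed
    moreover have "(\<Sum>i=1..k. int (p i) * (a i - a j)) = \<sigma> - int (Suc \<alpha>) * a j"
      unfolding \<sigma>_def size_p[symmetric]
      by (simp add: right_diff_distrib sum_subtractf sum_distrib_right)
    moreover have "(\<Sum>i=1..k. int (x i) * (a i - a j)) = s - int (\<Sum>i=1..k. x i) * a j"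
      unfolding x(3) by (simp add: right_diff_distrib sum_subtractf sum_distrib_right)
    moreover have "int (Suc \<alpha>) * a j \<le> int (\<Sum>i=1..k. x i) * a j"
      using x(2) a_pos[OF j] by (intro mult_right_mono) linarith+
    ultimately show ?thesis by linarith
  qed
  define N where "N = (\<lambda>i. \<sigma> - a i) ` {1..j}"
  have "N \<subseteq> S \<alpha>"
  proof
    fix s assume "s \<in> N"
    then obtain i where i: "i \<in> {1..j}" "s = \<sigma> - a i" by (auto simp: N_def)
    have ik: "i \<in> {1..k}" using i j by auto
    define x where "x = p(i := p i - 1)"
    have "(\<Sum>q=1..k. int (x q) * a q) = (\<Sum>q=1..k. int (p q) * a q - (if q = i then a q else 0))"
      using p_pos[OF i(1)] by (intro sum.cong) (auto simp: x_def algebra_simps of_nat_diff)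
    then have 1: "(\<Sum>q=1..k. int (x q) * a q) = s"
      using ik unfolding i(2) \<sigma>_def sum_subtractf by simp
    have "(\<Sum>q=1..k. x q + (if q = i then 1 else 0)) = (\<Sum>q=1..k. p q)"
      using p_pos[OF i(1)] by (intro sum.cong) (auto simp: x_def)
    then have 2: "(\<Sum>q=1..k. x q) = \<alpha>"
      using ik unfolding size_p sum.distrib by simp
    have "\<forall>q\<in>{1..k}. x q \<le> r q" using p_le by (auto simp: x_def intro: order_trans[OF diff_le_self])
    then show "s \<in> S \<alpha>"
      unfolding subseq_sums_seq_of[OF inj_a] using 1 2 by (auto intro!: exI[of _ x])
  qed
  moreover have "S (Suc \<alpha>) \<subseteq> S \<alpha>" by (auto simp: subseq_sums_def)
  moreover have "S (Suc \<alpha>) \<inter> N = {}"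
    using minimal a_pos j by (fastforce simp: N_def)
  moreover have "card N = j"
  proof -
    have "inj_on (\<lambda>i. \<sigma> - a i) {1..j}"
      by (rule inj_onI, rule inj_onD[OF inj_a]) (use j in auto)
    then show ?thesis by (simp add: N_def card_image)
  qed
  ultimately show ?thesis
    using card_mono[of "S \<alpha>" "S (Suc \<alpha>) \<union> N"] card_Un_disjoint[of "S (Suc \<alpha>)" N]
    by (simp add: finite_subseq_sums N_def)
qed

text \<open>The term values modulo \<open>a k\<close>, already reduced because \<open>a k\<close> is
  the largest; 0 stands for \<open>a k\<close> and for the empty choice.\<close>

abbreviation residues :: "int set" where "residues \<equiv> insert 0 (a ` {1..k-1})"

lemma residues_subset:
  assumes "k \<ge> 1"
  shows "residues \<subseteq> {0..<a k}"
proof -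
  have "0 \<le> a i \<and> a i < a k" if "i \<in> {1..k-1}" for i
  proof -
    have "i \<in> {1..k}" "i < k" using that assms by auto
    then show ?thesis using a_pos[of i] a_less_iff[of i k] by auto
  qed
  then show ?thesis using a_pos assms by auto
qed

lemma card_residues:
  assumes "k \<ge> 1"
  shows "card residues = k"
proof -
  have "inj_on a {1..k-1}" using inj_a by (rule inj_on_subset) auto
  moreover have "0 \<notin> a ` {1..k-1}"
  proof
    assume "0 \<in> a ` {1..k-1}"
    then obtain i where "i \<in> {1..k}" "a i = 0" by force
    then show False using a_pos[of i] by simp
  qed
  ultimately show ?thesis using assms by (simp add: card_image)
qed

text \<open>All thresholds from \<alpha> to \<open>R j - 1\<close> lie in block \<open>j\<close>, so
  the gain \<open>j\<close> of a single step accumulates.\<close>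

lemma card_S_within_block:
  assumes j: "j \<in> {1..k}" and "\<alpha> \<le> R j" and "R (j - 1) \<le> \<alpha>"
  shows "card (S (R j)) + j * (R j - \<alpha>) \<le> card (S \<alpha>)"
  using assms(2,3)
proof (induction rule: inc_induct)
  case (step n)
  have "R j - n = Suc (R j - Suc n)" using step.hyps by linarith
  then have "j * (R j - n) = j * (R j - Suc n) + j" by (metis add.commute mult_Suc_right)
  then show ?case using card_S_Suc[OF j, of n] step by linarith
qed simp

lemma card_S_blocks:
  assumes "m \<le> n" "n \<le> k"
  shows "card (S (R n)) + (\<Sum>i=m+1..n. i * r i) \<le> card (S (R m))"
  using assms
proof (induction rule: inc_induct)
  case (step n')
  have "R (Suc n') = R n' + r (Suc n')" by simp
  then have "card (S (R (Suc n'))) + Suc n' * r (Suc n') \<le> card (S (R n'))"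
    using card_S_within_block[of "Suc n'" "R n'"] step by simp
  moreover have "(\<Sum>i=n'+1..n. i * r i) = Suc n' * r (Suc n') + (\<Sum>i=Suc n'+1..n. i * r i)"
    using step by (simp add: sum.atLeast_Suc_atMost)
  ultimately show ?case using step by linarith
qed simp

text \<open>Subtracting from the total of all terms turns \<open>S \<alpha>\<close> into the sums of at most \<open>\<beta>\<close> terms.
  Modulo \<open>a k\<close>, a residue in \<open>A\<close> is then attained by at most one term other than \<open>a k\<close>, a residue
  in \<open>T\<close> by at most two, and adding copies of \<open>a k\<close> gives further elements of its class.\<close>

lemma card_S_ge_mod_pair_sums:
  fixes A T defines "A \<equiv> residues" and "T \<equiv> mod_pair_sums (a k) A"
  assumes k1: "k \<ge> 1" and \<alpha>\<beta>: "\<alpha> + \<beta> = R k" and \<beta>: "2 \<le> \<beta>" "\<beta> \<le> r k + 1"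
  shows "(\<beta> - 1) * card T + k \<le> card (S \<alpha>)"
proof -
  define l where "l = a k"
  define U where "U = (\<lambda>s. (\<Sum>i=1..k. int (r i) * a i) - s) ` S \<alpha>"
  have finU: "finite U" by (simp add: U_def finite_subseq_sums)
  have cardU: "card U = card (S \<alpha>)" unfolding U_def by (intro card_image) (simp add: inj_on_def)
  have l0: "l > 0" using a_pos k1 by (simp add: l_def)
  have Asub: "A \<subseteq> {0..<l}" and cardA: "card A = k"
    using residues_subset[OF k1] card_residues[OF k1] by (simp_all add: A_def l_def)
  have AT: "A \<subseteq> T"
    using subset_mod_pair_sums[OF Asub] unfolding T_def l_def by (simp add: A_def)
  have finT: "finite T"
    using mod_pair_sums_subset[OF l0] finite_subset unfolding T_def l_def by blast
  have mem: "(\<Sum>i\<in>I. a i) + int j * l \<in> U"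
    if I: "I \<subseteq> {1..k-1}" and j: "j \<le> r k" "card I + j \<le> \<beta>" for I j
  proof -
    define x where "x i = (if i \<in> I then 1 else 0) + (if i = k then j else 0)" for i
    have kI: "k \<notin> I" "I \<subseteq> {1..k}" "{1..k} \<inter> I = I" using I k1 by force+
    have finI: "finite I" using I finite_subset by blast
    have "\<forall>i\<in>{1..k}. x i \<le> r i" using kI j r_pos by (auto simp: x_def)
    moreover have "(\<Sum>i=1..k. x i) = card I + j"
      using kI finI k1 by (simp add: x_def sum.distrib flip: sum.inter_restrict)
    moreover have "(\<Sum>i=1..k. int (x i) * a i) = (\<Sum>i\<in>I. a i) + int j * l"
    proof -
      have "(\<Sum>i=1..k. int (x i) * a i)
        = (\<Sum>i=1..k. (if i \<in> I then a i else 0) + (if i = k then int j * a i else 0))"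
        using kI by (intro sum.cong) (auto simp: x_def)
      also have "\<dots> = (\<Sum>i\<in>I. a i) + int j * l"
        using kI k1 by (simp add: sum.distrib l_def flip: sum.inter_restrict)
      finally show ?thesis .
    qed
    ultimately have "(\<Sum>i=1..k. int (r i) * a i) - ((\<Sum>i\<in>I. a i) + int j * l) \<in> S \<alpha>"
      using total_minus_mem_subseq_sums[OF inj_a, of x r \<alpha>] j \<alpha>\<beta> by simp
    then show ?thesis unfolding U_def by (auto intro!: image_eqI)
  qed
  have A_idx: "\<exists>I. I \<subseteq> {1..k-1} \<and> card I \<le> 1 \<and> (\<Sum>i\<in>I. a i) = x" if "x \<in> A" for x
    using that unfolding A_def
  proof (elim insertE imageE)
    show ?thesis if "x = 0" using that by (intro exI[of _ "{}"]) simp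
    show ?thesis if "x = a i" "i \<in> {1..k-1}" for i using that by (intro exI[of _ "{i}"]) simp
  qed
  have memA: "x + int j * l \<in> U" if "x \<in> A" "j < \<beta>" for x j
    using A_idx[OF that(1)] mem[of _ j] that(2) \<beta> by fastforce
  have mem2: "x + y + int j * l \<in> U" if xy: "x \<in> A" "y \<in> A" "x \<noteq> y" and j: "j < \<beta> - 1" for x y j
  proof (cases "x = 0 \<or> y = 0")
    case True
    then show ?thesis using memA[of _ j] xy j by auto
  next
    case False
    then obtain i i' where i: "i \<in> {1..k-1}" "i' \<in> {1..k-1}" "x = a i" "y = a i'"
      using xy by (auto simp: A_def)
    then have "i \<noteq> i'" using xy by auto
    then show ?thesis using mem[of "{i, i'}" j] i j \<beta> by simp
  qed
  \<comment> \<open>One term outside the copies of \<open>a k\<close> leaves room for up to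
    \<open>\<beta> - 1\<close> copies, two terms for up to \<open>\<beta> - 2\<close>. These copies
    exist because \<open>\<beta> \<le> r k + 1\<close>.\<close>
  have "\<exists>z. z mod l = c \<and> (\<forall>j < (if c \<in> A then \<beta> else \<beta> - 1). z + int j * l \<in> U)"
    if c: "c \<in> T" for c
  proof (cases "c \<in> A")
    case True
    then show ?thesis using memA Asub by (intro exI[of _ c]) auto
  next
    case False
    then obtain x y where "x \<in> A" "y \<in> A" "x \<noteq> y" "c = (x + y) mod l"
      using c unfolding T_def mod_pair_sums_def l_def by (auto simp: A_def)
    then show ?thesis using mem2[of x y] False by (intro exI[of _ "x + y"]) auto
  qed
  then obtain z where z: "\<And>c. c \<in> T \<Longrightarrow> z c mod l = c"
    "\<And>c j. c \<in> T \<Longrightarrow> j < (if c \<in> A then \<beta> else \<beta> - 1) \<Longrightarrow> z c + int j * l \<in> U"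
    by metis
  \<comment> \<open>Pairs of a class and a number of copies: the sum modulo \<open>l\<close>
    recovers the class, and then its size the number.\<close>
  define G where "G = (SIGMA c:T. {..<if c \<in> A then \<beta> else \<beta> - 1})"
  have "card G \<le> card U"
  proof (rule card_inj_on_le[where f = "\<lambda>(c, j). z c + int j * l"])
    show "inj_on (\<lambda>(c, j). z c + int j * l) G"
    proof (rule inj_onI)
      fix p q assume pq: "p \<in> G" "q \<in> G"
        and "(\<lambda>(c, j). z c + int j * l) p = (\<lambda>(c, j). z c + int j * l) q"
      then have eq: "z (fst p) + int (snd p) * l = z (fst q) + int (snd q) * l"
        by (simp add: case_prod_unfold)
      then have "(z (fst p) + int (snd p) * l) mod l = (z (fst q) + int (snd q) * l) mod l" by simp
      then have "fst p = fst q" using z(1) pq by (auto simp: G_def)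
      then show "p = q" using eq l0 by (simp add: prod_eq_iff)
    qed
    show "(\<lambda>(c, j). z c + int j * l) ` G \<subseteq> U" using z(2) by (auto simp: G_def)
  qed (rule finU)
  moreover have "card G = (\<Sum>c\<in>T. (\<beta> - 1) + (if c \<in> A then 1 else 0))"
    unfolding G_def using finT \<beta> by (subst card_SigmaI) (auto intro!: sum.cong)
  moreover have "\<dots> = (\<beta> - 1) * card T + k"
    using AT finT cardA by (simp add: sum.distrib Int_absorb1 flip: sum.inter_restrict)
  ultimately show ?thesis using cardU by simp
qed

end

section \<open>Numerical estimates and the two ranges of \<alpha>\<close>

lemma golden_ratio_le: "golden_ratio \<le> 81 / 50"
proof -
  have "sqrt 5 \<le> 56 / 25" by (rule real_le_lsqrt) (auto simp: power2_eq_square)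
  then show ?thesis by (simp add: golden_ratio_def)
qed

theorem theorem6p5:
  fixes k \<alpha> :: nat and a :: "nat \<Rightarrow> int" and r :: "nat \<Rightarrow> nat"
  assumes "k \<ge> 3"
    and "\<forall>i\<in>{1..k}. a i > 0"
    and "strict_mono_on {1..k} a"
    and "\<forall>i\<in>{1..k-2}. r i \<ge> 1"
    and "r (k - 1) = 1"
    and "r k \<ge> 2"
    and "Gcd (a ` {1..k}) = 1"
    and "\<alpha> > 0"
    and "int \<alpha> < int (\<Sum>i=1..k. r i) - 2"
  shows
    "(\<alpha> < (\<Sum>i=1..k-2. r i) \<longrightarrow>
       (\<exists>m\<in>{1..k-2}.
          (\<Sum>i=1..m-1. r i) \<le> \<alpha> \<and> \<alpha> < (\<Sum>i=1..m. r i) \<and>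
          (a k \<le> 2 * int k - 3 \<longrightarrow>
             real (card (subseq_sums \<alpha> (seq_of k a r))) \<ge>
               real_of_int (a k) + real k
               + (\<Sum>i=1..k-2. real i * real (r i)) - (\<Sum>i=1..m. real i * real (r i))
               + real m * ((\<Sum>i=1..m. real (r i)) - real \<alpha>)
               + (real k - real m + 1) * (real (r k) - 1)) \<and>
          (a k \<ge> 2 * int k - 2 \<longrightarrow>
             real (card (subseq_sums \<alpha> (seq_of k a r))) \<ge>
               golden_ratio * (real k + 1) + real k - 4
               + (\<Sum>i=1..k-2. real i * real (r i)) - (\<Sum>i=1..m. real i * real (r i))
               + real m * ((\<Sum>i=1..m. real (r i)) - real \<alpha>)
               + (real k - real m + 1) * (real (r k) - 1)))) \<and>
     ((\<Sum>i=1..k-2. r i) \<le> \<alpha> \<and> int \<alpha> < int (\<Sum>i=1..k. r i) - 2 \<longrightarrow>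
       (a k \<le> 2 * int k - 3 \<longrightarrow>
          real (card (subseq_sums \<alpha> (seq_of k a r))) \<ge>
            real_of_int (a k) - real k + 2
            + (real k - 1) * ((\<Sum>i=1..k. real (r i)) - real \<alpha>)) \<and>
       (a k \<ge> 2 * int k - 2 \<longrightarrow>
          real (card (subseq_sums \<alpha> (seq_of k a r))) \<ge>
            golden_ratio * (real k + 1) - real k - 2
            + (real k - 1) * ((\<Sum>i=1..k. real (r i)) - real \<alpha>)))"
proof -
  define l T t where "l = a k" and "T = mod_pair_sums l (insert 0 (a ` {1..k-1}))" and "t = card T"
  have k3: "k \<ge> 3" and rk: "r k \<ge> 2" using assms by auto
  have r_pos: "r i \<ge> 1" if "i \<in> {1..k}" for i
  proof -
    have "i \<in> {1..k-2} \<or> i = k - 1 \<or> i = k" using that by auto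
    then show ?thesis using assms(4-6) by auto
  qed
  interpret repeated_terms k a r
    using assms(2,3) r_pos by unfold_locales auto
  have residues: "residues \<subseteq> {0..<l}" "card residues = k" "0 \<in> residues"
    using residues_subset card_residues k3 by (auto simp: l_def)
  have l0: "l > 0" using a_pos k3 by (simp add: l_def)
  have t_ge_k: "t \<ge> k"
  proof -
    have "finite T" using mod_pair_sums_subset[OF l0] finite_subset unfolding T_def by blast
    then show ?thesis
      using card_mono[OF _ subset_mod_pair_sums[OF residues(1,3)]] residues(2)
      unfolding t_def T_def by simp
  qed
  have small: "real_of_int (a k) = real t" if "a k \<le> 2 * int k - 3"
  proof -
    have "T = {0..<l}" unfolding T_def
      by (rule mod_pair_sums_eq_all_residues) (use that residues l0 in \<open>auto simp: l_def\<close>)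
    then show ?thesis using l0 by (simp add: t_def l_def)
  qed
  have large: "2 * real t \<ge> 3 * real k - 3" if "a k \<ge> 2 * int k - 2"
  proof -
    have "a ` {1..k} = insert (a k) (a ` {1..k-1})"
      using k3 by (cases k) (auto simp: atLeastAtMostSuc_conv)
    then have "Gcd (insert l residues) = 1" using assms(7) by (simp add: l_def)
    then have "2 * int (card T) \<ge> 3 * int (card residues) - 3" unfolding T_def
      by (intro card_mod_pair_sums_ge) (use that residues k3 in \<open>auto simp: l_def\<close>)
    then show ?thesis unfolding residues(2) t_def by linarith
  qed
  have base: "(\<beta> - 1) * t + k \<le> card (S \<alpha>)" if "\<alpha> + \<beta> = R k" "2 \<le> \<beta>" "\<beta> \<le> r k + 1" for \<alpha> \<beta>
    using card_S_ge_mod_pair_sums[of \<alpha> \<beta>] that k3 unfolding t_def T_def l_def by simp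
  have "k = Suc (Suc (k - 2))" "k - 1 = Suc (k - 2)" using k3 by linarith+
  then have Rk: "R k = R (k - 2) + 1 + r k"
    using assms(5) sum.cl_ivl_Suc[of r 1 "k - 2"] sum.cl_ivl_Suc[of r 1 "Suc (k - 2)"] by simp
  have "golden_ratio * (real k + 1) \<le> 81 / 50 * (real k + 1)"
    using golden_ratio_le by (intro mult_right_mono) auto
  then have golden_bound: "golden_ratio * (real k + 1) \<le> 2 * real k + 1"
    using k3 by (simp add: field_simps)
  have real: "real k \<ge> 3" "real (r k) \<ge> 2" "real t \<ge> real k" using k3 rk t_ge_k by auto
  show ?thesis
  proof (intro conjI impI)
    assume \<alpha>: "\<alpha> < R (k - 2)"
    \<comment> \<open>The block containing the threshold.\<close>
    define m where "m = (LEAST m. \<alpha> < R m)"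
    have m_up: "\<alpha> < R m" unfolding m_def using \<alpha> by (rule LeastI)
    have m_le: "m \<le> k - 2" unfolding m_def using \<alpha> by (rule Least_le)
    have m1: "m \<ge> 1" using m_up by (cases m) auto
    have "m \<le> k" using m_le by simp
    have m_low: "R (m - 1) \<le> \<alpha>"
      using not_less_Least[of "m - 1" "\<lambda>m. \<alpha> < R m"] m1 unfolding m_def[symmetric] by simp
    define g where "g = (\<Sum>i=m+1..k-2. i * r i) + m * (R m - \<alpha>)"
    \<comment> \<open>Since \<open>r (k - 1) = 1\<close>, the threshold \<open>R (k - 2)\<close> has
      \<open>\<beta> = r k + 1\<close>, the largest value \<open>base\<close> admits. From there
      whole blocks lead down to \<open>R m\<close>, and single steps on to \<alpha>.\<close>
    have "r k * t + k + g \<le> card (S \<alpha>)"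
      using base[of "R (k - 2)" "r k + 1"] Rk rk card_S_blocks[OF m_le]
        card_S_within_block[of m \<alpha>] m1 \<open>m \<le> k\<close> m_up m_low by (simp add: g_def)
    then have C: "real (r k) * real t + real k + real g \<le> real (card (S \<alpha>))"
      by (simp flip: of_nat_mult of_nat_add)
    have split: "(\<Sum>i=1..k-2. f i) = (\<Sum>i=1..m. f i) + (\<Sum>i=m+1..k-2. f i)" for f :: "nat \<Rightarrow> real"
      using sum.ub_add_nat[of 1 m f "k - 2 - m"] unfolding le_add_diff_inverse[OF m_le] by simp
    have g: "real g = (\<Sum>i=1..k-2. real i * real (r i)) - (\<Sum>i=1..m. real i * real (r i))
        + real m * ((\<Sum>i=1..m. real (r i)) - real \<alpha>)"
      using m_up unfolding split by (simp add: g_def of_nat_diff)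
    have mk: "(real k - real m + 1) * (real (r k) - 1) \<le> real k * (real (r k) - 1)"
      using m1 real by (intro mult_right_mono) auto
    have kt: "real k * (real (r k) - 1) \<le> real t * (real (r k) - 1)"
      using real by (intro mult_right_mono) auto
    show "\<exists>m\<in>{1..k-2}. R (m - 1) \<le> \<alpha> \<and> \<alpha> < R m \<and>
          (a k \<le> 2 * int k - 3 \<longrightarrow>
             real (card (S \<alpha>)) \<ge>
               real_of_int (a k) + real k
               + (\<Sum>i=1..k-2. real i * real (r i)) - (\<Sum>i=1..m. real i * real (r i))
               + real m * ((\<Sum>i=1..m. real (r i)) - real \<alpha>)
               + (real k - real m + 1) * (real (r k) - 1)) \<and>
          (a k \<ge> 2 * int k - 2 \<longrightarrow>
             real (card (S \<alpha>)) \<ge>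
               golden_ratio * (real k + 1) + real k - 4
               + (\<Sum>i=1..k-2. real i * real (r i)) - (\<Sum>i=1..m. real i * real (r i))
               + real m * ((\<Sum>i=1..m. real (r i)) - real \<alpha>)
               + (real k - real m + 1) * (real (r k) - 1))"
    proof (intro bexI[of _ m] conjI impI)
      assume "a k \<le> 2 * int k - 3"
      then have "real t = real_of_int (a k)" using small by simp
      moreover have "real (r k) * real t = real t + real t * (real (r k) - 1)"
        by (simp add: algebra_simps)
      ultimately show "real (card (S \<alpha>)) \<ge>
               real_of_int (a k) + real k
               + (\<Sum>i=1..k-2. real i * real (r i)) - (\<Sum>i=1..m. real i * real (r i))
               + real m * ((\<Sum>i=1..m. real (r i)) - real \<alpha>)
               + (real k - real m + 1) * (real (r k) - 1)"
        using C g mk kt by linarith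
    next
      assume "a k \<ge> 2 * int k - 2"
      then have "2 * real t \<ge> 3 * real k - 3" by (rule large)
      \<comment> \<open>Two of the \<open>r k\<close> copies of \<open>t\<close> are estimated by
        \<open>large\<close>, the others by \<open>t \<ge> k\<close>.\<close>
      moreover have "(real (r k) - 2) * real k \<le> (real (r k) - 2) * real t"
        using real by (intro mult_left_mono) auto
      ultimately have "real k * (real (r k) - 1) + 2 * real k - 3 \<le> real (r k) * real t"
        by (simp add: algebra_simps)
      then show "real (card (S \<alpha>)) \<ge>
               golden_ratio * (real k + 1) + real k - 4
               + (\<Sum>i=1..k-2. real i * real (r i)) - (\<Sum>i=1..m. real i * real (r i))
               + real m * ((\<Sum>i=1..m. real (r i)) - real \<alpha>)
               + (real k - real m + 1) * (real (r k) - 1)"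
        using C g mk golden_bound by linarith
    qed (use m1 m_le m_up m_low in auto)
  next
    assume \<alpha>: "R (k - 2) \<le> \<alpha> \<and> int \<alpha> < int (R k) - 2"
    define \<beta> where "\<beta> = R k - \<alpha>"
    \<comment> \<open>The strict upper bound on \<alpha> gives \<open>\<beta> \<ge> 3\<close>;
      \<open>R (k - 2) \<le> \<alpha>\<close> together with \<open>r (k - 1) = 1\<close> gives
      \<open>\<beta> \<le> r k + 1\<close>. So \<open>base\<close> applies directly.\<close>
    have \<beta>: "\<alpha> + \<beta> = R k" "3 \<le> \<beta>" "\<beta> \<le> r k + 1"
      using \<alpha> Rk unfolding \<beta>_def by linarith+
    have "(\<beta> - 1) * t + k \<le> card (S \<alpha>)" using base \<beta> by simp
    then have "real ((\<beta> - 1) * t + k) \<le> real (card (S \<alpha>))" by (rule of_nat_mono)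
    \<comment> \<open>Two copies of \<open>t\<close> are split off for the bound
      \<open>large\<close>; the other \<open>\<beta> - 3\<close> only need
      \<open>t \<ge> k\<close>.\<close>
    moreover have "real ((\<beta> - 1) * t + k) = 2 * real t + real (\<beta> - 3) * real t + real k"
    proof -
      have "\<beta> - 1 = 2 + (\<beta> - 3)" using \<beta>(2) by linarith
      then show ?thesis by (simp only: of_nat_add of_nat_mult distrib_right of_nat_numeral)
    qed
    ultimately have C: "2 * real t + real (\<beta> - 3) * real t + real k \<le> real (card (S \<alpha>))" by simp
    have \<beta>_real: "(\<Sum>i=1..k. real (r i)) - real \<alpha> = real (\<beta> - 3) + 3"
    proof -
      have "real (R k) = real \<alpha> + (real (\<beta> - 3) + 3)" using \<beta> by linarith
      then show ?thesis by simp
    qed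
    have kt: "real (\<beta> - 3) * real k \<le> real (\<beta> - 3) * real t"
      using real by (intro mult_left_mono) auto
    have rhs: "(real k - 1) * (real (\<beta> - 3) + 3) = real (\<beta> - 3) * real k - real (\<beta> - 3) + 3 * real k - 3"
      by (simp add: algebra_simps)
    show "real_of_int (a k) - real k + 2 + (real k - 1) * ((\<Sum>i=1..k. real (r i)) - real \<alpha>)
        \<le> real (card (S \<alpha>))" if "a k \<le> 2 * int k - 3"
      unfolding \<beta>_real rhs small[OF that] using C kt real by linarith
    show "golden_ratio * (real k + 1) - real k - 2
        + (real k - 1) * ((\<Sum>i=1..k. real (r i)) - real \<alpha>) \<le> real (card (S \<alpha>))"
      if "a k \<ge> 2 * int k - 2"
      unfolding \<beta>_real rhs using C kt real large[OF that] golden_bound by linarith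
  qed
qed

end
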